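(* Let $(A,\sigma)$ be a state BL-algebra. Then $A$ is perfect if and only if both of the following hold: (i) for every $x\in A$, $\sigma(x)\in\mathrm{Rad}(A)$ implies $x\in\mathrm{Rad}(A)$; and (ii) the BL-algebra $\sigma(A)$ is perfect.
   Context: A BL-algebra is an algebra $(A,\wedge,\vee,\odot,\to,0,1)$ of type $(2,2,2,2,0,0)$ such that $(A,\wedge,\vee,0,1)$ is a bounded lattice, $(A,\odot,1)$ is a commutative monoid, and for all $a,b,c\in A$: $c\le a\to b$ iff $a\odot c\le b$; $a\wedge b=a\odot(a\to b)$; $(a\to b)\vee(b\to a)=1$. Write $x^-:=x\to0$. A state-operator on $A$ is a map $\sigma:A\to A$ such that for all $x,y\in A$: (1) $\sigma(0)=0$; (2) $\sigma(x\to y)=\sigma(x)\to\sigma(x\wedge y)$; (3) $\sigma(x\odot y)=\sigma(x)\odot\sigma(x\to x\odot y)$; (4) $\sigma(\sigma(x)\odot\sigma(y))=\sigma(x)\odot\sigma(y)$; (5) $\sigma(\sigma(x)\to\sigma(y))=\sigma(x)\to\sigma(y)$. The image $\sigma(A)$ is a subalgebra, regarded as a BL-algebra. A filter is a nonempty subset closed under $\odot$ and upward closed; a maximal filter is a proper filter not strictly contained in another proper filter; $\mathrm{Rad}(B)$ is the intersection of all maximal filters of a BL-algebra $B$, and $\mathrm{Rad}(B)^-=\{x^-:x\in\mathrm{Rad}(B)\}$. A BL-algebra $B$ is perfect if every $x\in B$ lies in $\mathrm{Rad}(B)$ or in $\mathrm{Rad}(B)^-$. *)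

theory Defs
  imports "HOL-Algebra.Group"
begin

text \<open>
  BL-algebras are given on an explicit carrier, because a subalgebra has to be treated as a
  BL-algebra of its own. The monoid operation and its unit (which is also the top of the lattice)
  are those of the underlying \<^type>\<open>monoid_ext\<close> record.
\<close>

record 'a bl = "'a monoid" +
  bl_meet :: "['a, 'a] \<Rightarrow> 'a" (infixl "\<curlywedge>\<index>" 70)
  bl_join :: "['a, 'a] \<Rightarrow> 'a" (infixl "\<curlyvee>\<index>" 65)
  bl_imp :: "['a, 'a] \<Rightarrow> 'a" (infixr "\<leadsto>\<index>" 60)
  bl_zero :: 'a ("\<zero>\<index>")

definition bl_le :: "('a, 'm) bl_scheme \<Rightarrow> 'a \<Rightarrow> 'a \<Rightarrow> bool" (infix "\<preceq>\<index>" 50)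
  where "x \<preceq>\<^bsub>A\<^esub> y \<longleftrightarrow> x \<curlywedge>\<^bsub>A\<^esub> y = x"

definition bl_neg :: "('a, 'm) bl_scheme \<Rightarrow> 'a \<Rightarrow> 'a"
  where "bl_neg A x = x \<leadsto>\<^bsub>A\<^esub> \<zero>\<^bsub>A\<^esub>"

locale bl_algebra = comm_monoid A for A :: "('a, 'm) bl_scheme" (structure) +
  assumes meet_closed: "\<lbrakk>x \<in> carrier A; y \<in> carrier A\<rbrakk> \<Longrightarrow> x \<curlywedge> y \<in> carrier A"
    and join_closed: "\<lbrakk>x \<in> carrier A; y \<in> carrier A\<rbrakk> \<Longrightarrow> x \<curlyvee> y \<in> carrier A"
    and imp_closed: "\<lbrakk>x \<in> carrier A; y \<in> carrier A\<rbrakk> \<Longrightarrow> x \<leadsto> y \<in> carrier A"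
    and zero_closed: "\<zero> \<in> carrier A"
    and meet_comm: "\<lbrakk>x \<in> carrier A; y \<in> carrier A\<rbrakk> \<Longrightarrow> x \<curlywedge> y = y \<curlywedge> x"
    and join_comm: "\<lbrakk>x \<in> carrier A; y \<in> carrier A\<rbrakk> \<Longrightarrow> x \<curlyvee> y = y \<curlyvee> x"
    and meet_assoc:
      "\<lbrakk>x \<in> carrier A; y \<in> carrier A; z \<in> carrier A\<rbrakk> \<Longrightarrow> (x \<curlywedge> y) \<curlywedge> z = x \<curlywedge> (y \<curlywedge> z)"
    and join_assoc:
      "\<lbrakk>x \<in> carrier A; y \<in> carrier A; z \<in> carrier A\<rbrakk> \<Longrightarrow> (x \<curlyvee> y) \<curlyvee> z = x \<curlyvee> (y \<curlyvee> z)"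
    and meet_join_absorb: "\<lbrakk>x \<in> carrier A; y \<in> carrier A\<rbrakk> \<Longrightarrow> x \<curlywedge> (x \<curlyvee> y) = x"
    and join_meet_absorb: "\<lbrakk>x \<in> carrier A; y \<in> carrier A\<rbrakk> \<Longrightarrow> x \<curlyvee> (x \<curlywedge> y) = x"
    and zero_least: "x \<in> carrier A \<Longrightarrow> \<zero> \<preceq> x"
    and one_greatest: "x \<in> carrier A \<Longrightarrow> x \<preceq> \<one>"
    and residuation:
      "\<lbrakk>a \<in> carrier A; b \<in> carrier A; c \<in> carrier A\<rbrakk> \<Longrightarrow> c \<preceq> a \<leadsto> b \<longleftrightarrow> a \<otimes> c \<preceq> b"
    and divisibility: "\<lbrakk>a \<in> carrier A; b \<in> carrier A\<rbrakk> \<Longrightarrow> a \<curlywedge> b = a \<otimes> (a \<leadsto> b)"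
    and prelinearity:
      "\<lbrakk>a \<in> carrier A; b \<in> carrier A\<rbrakk> \<Longrightarrow> (a \<leadsto> b) \<curlyvee> (b \<leadsto> a) = \<one>"

locale state_bl_algebra = bl_algebra A for A :: "('a, 'm) bl_scheme" (structure) +
  fixes \<sigma> :: "'a \<Rightarrow> 'a"
  assumes state_closed: "x \<in> carrier A \<Longrightarrow> \<sigma> x \<in> carrier A"
    and state_zero: "\<sigma> \<zero> = \<zero>"
    and state_imp:
      "\<lbrakk>x \<in> carrier A; y \<in> carrier A\<rbrakk> \<Longrightarrow> \<sigma> (x \<leadsto> y) = \<sigma> x \<leadsto> \<sigma> (x \<curlywedge> y)"
    and state_mult:
      "\<lbrakk>x \<in> carrier A; y \<in> carrier A\<rbrakk> \<Longrightarrow> \<sigma> (x \<otimes> y) = \<sigma> x \<otimes> \<sigma> (x \<leadsto> x \<otimes> y)"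
    and state_mult_image:
      "\<lbrakk>x \<in> carrier A; y \<in> carrier A\<rbrakk> \<Longrightarrow> \<sigma> (\<sigma> x \<otimes> \<sigma> y) = \<sigma> x \<otimes> \<sigma> y"
    and state_imp_image:
      "\<lbrakk>x \<in> carrier A; y \<in> carrier A\<rbrakk> \<Longrightarrow> \<sigma> (\<sigma> x \<leadsto> \<sigma> y) = \<sigma> x \<leadsto> \<sigma> y"

text \<open>
  The image of a state-operator is closed under all operations: under product and residuum by the
  last two axioms, hence under meet by divisibility, and under join because
  \<open>x \<curlyvee> y = ((x \<leadsto> y) \<leadsto> y) \<curlywedge> ((y \<leadsto> x) \<leadsto> x)\<close>. So restricting the carrier gives the subalgebra.
\<close>

definition bl_image :: "('a, 'm) bl_scheme \<Rightarrow> ('a \<Rightarrow> 'a) \<Rightarrow> ('a, 'm) bl_scheme"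
  where "bl_image A \<sigma> = A\<lparr>carrier := \<sigma> ` carrier A\<rparr>"

definition bl_filter :: "('a, 'm) bl_scheme \<Rightarrow> 'a set \<Rightarrow> bool"
  where "bl_filter A F \<longleftrightarrow> F \<subseteq> carrier A \<and> F \<noteq> {} \<and>
    (\<forall>x\<in>F. \<forall>y\<in>F. x \<otimes>\<^bsub>A\<^esub> y \<in> F) \<and>
    (\<forall>x\<in>F. \<forall>y\<in>carrier A. x \<preceq>\<^bsub>A\<^esub> y \<longrightarrow> y \<in> F)"

definition bl_proper_filter :: "('a, 'm) bl_scheme \<Rightarrow> 'a set \<Rightarrow> bool"
  where "bl_proper_filter A F \<longleftrightarrow> bl_filter A F \<and> F \<noteq> carrier A"

definition bl_maximal_filter :: "('a, 'm) bl_scheme \<Rightarrow> 'a set \<Rightarrow> bool"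
  where "bl_maximal_filter A F \<longleftrightarrow>
    bl_proper_filter A F \<and> \<not> (\<exists>G. bl_proper_filter A G \<and> F \<subset> G)"

text \<open>
  Intersecting with the carrier only matters for the one-element algebra, which has no maximal
  filter: the empty intersection is then taken to be the whole algebra.
\<close>

definition bl_Rad :: "('a, 'm) bl_scheme \<Rightarrow> 'a set"
  where "bl_Rad A = carrier A \<inter> \<Inter> {F. bl_maximal_filter A F}"

definition bl_perfect :: "('a, 'm) bl_scheme \<Rightarrow> bool"
  where "bl_perfect A \<longleftrightarrow> (\<forall>x\<in>carrier A. x \<in> bl_Rad A \<or> x \<in> bl_neg A ` bl_Rad A)"

end

theory Submission
  imports Defs
begin

text \<open>
  Call \<open>u\<close> nilpotent if some power of it is \<open>\<zero>\<close>. Zorn's lemma describes the radical by elements: \<open>x \<in> Rad A\<close> iff every \<open>(x\<^sup>n)\<^sup>-\<close> is nilpotent. It is inherited by subalgebras, so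
  \<open>Rad (\<sigma> A) = Rad A \<inter> \<sigma> A\<close>. Prelinearity enters through the remark that \<open>u \<or> v = 1\<close> with \<open>u\<close>
  nilpotent forces \<open>v = 1\<close>. It yields \<open>z\<^sup>- \<le> z\<close> for \<open>z \<in> Rad A\<close>, whence
  \<open>(\<sigma> z)\<^sup>- \<le> \<sigma> z\<close>, which for perfect \<open>A\<close> gives (i); and it yields \<open>x\<^sup>-\<^sup>- = x\<close> whenever
  \<open>x\<^sup>-\<close> lies in the radical, although double negation is not the identity in general. The latter
  turns \<open>x\<^sup>- \<in> Rad A\<close> into \<open>x \<in> (Rad A)\<^sup>-\<close>.
\<close>

section \<open>Order, lattice and residuation laws\<close>

context bl_algebra
begin

abbreviation neg :: "'a \<Rightarrow> 'a"
  where "neg \<equiv> bl_neg A"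

lemma neg_closed [simp]: "x \<in> carrier A \<Longrightarrow> neg x \<in> carrier A"
  by (simp add: bl_neg_def imp_closed zero_closed)

lemmas closed [simp] = meet_closed join_closed imp_closed zero_closed

lemma meet_idem: "x \<in> carrier A \<Longrightarrow> x \<curlywedge> x = x"
  by (metis meet_join_absorb join_meet_absorb meet_closed)

lemma le_refl [simp]: "x \<in> carrier A \<Longrightarrow> x \<preceq> x"
  by (simp add: bl_le_def meet_idem)

lemma le_antisym: "\<lbrakk>x \<preceq> y; y \<preceq> x; x \<in> carrier A; y \<in> carrier A\<rbrakk> \<Longrightarrow> x = y"
  by (metis bl_le_def meet_comm)

lemma le_trans:
  "\<lbrakk>x \<preceq> y; y \<preceq> z; x \<in> carrier A; y \<in> carrier A; z \<in> carrier A\<rbrakk> \<Longrightarrow> x \<preceq> z"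
  by (metis bl_le_def meet_assoc)

lemma meet_le1 [simp]: "\<lbrakk>x \<in> carrier A; y \<in> carrier A\<rbrakk> \<Longrightarrow> x \<curlywedge> y \<preceq> x"
  by (metis bl_le_def meet_assoc meet_comm meet_idem)

lemma meet_le2 [simp]: "\<lbrakk>x \<in> carrier A; y \<in> carrier A\<rbrakk> \<Longrightarrow> x \<curlywedge> y \<preceq> y"
  by (metis meet_le1 meet_comm)

lemma le_meetI:
  "\<lbrakk>z \<preceq> x; z \<preceq> y; x \<in> carrier A; y \<in> carrier A; z \<in> carrier A\<rbrakk> \<Longrightarrow> z \<preceq> x \<curlywedge> y"
  by (metis bl_le_def meet_assoc)

lemma le_iff_join: "\<lbrakk>x \<in> carrier A; y \<in> carrier A\<rbrakk> \<Longrightarrow> x \<preceq> y \<longleftrightarrow> x \<curlyvee> y = y"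
  by (metis bl_le_def meet_comm join_comm meet_join_absorb join_meet_absorb)

lemma le_join1 [simp]: "\<lbrakk>x \<in> carrier A; y \<in> carrier A\<rbrakk> \<Longrightarrow> x \<preceq> x \<curlyvee> y"
  by (simp add: bl_le_def meet_join_absorb)

lemma le_join2 [simp]: "\<lbrakk>x \<in> carrier A; y \<in> carrier A\<rbrakk> \<Longrightarrow> y \<preceq> x \<curlyvee> y"
  by (metis le_join1 join_comm)

lemma join_leI:
  "\<lbrakk>x \<preceq> z; y \<preceq> z; x \<in> carrier A; y \<in> carrier A; z \<in> carrier A\<rbrakk> \<Longrightarrow> x \<curlyvee> y \<preceq> z"
  by (simp add: le_iff_join join_assoc)

lemma le_zero_iff: "x \<in> carrier A \<Longrightarrow> x \<preceq> \<zero> \<longleftrightarrow> x = \<zero>"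
  using le_antisym zero_least by auto

lemma one_le_iff: "x \<in> carrier A \<Longrightarrow> \<one> \<preceq> x \<longleftrightarrow> x = \<one>"
  using le_antisym one_greatest by auto

lemma mult_left_mono:
  assumes "a \<preceq> b" and c: "a \<in> carrier A" "b \<in> carrier A" "c \<in> carrier A"
  shows "c \<otimes> a \<preceq> c \<otimes> b"
proof -
  have "b \<preceq> c \<leadsto> c \<otimes> b"
    using c by (simp add: residuation)
  then have "a \<preceq> c \<leadsto> c \<otimes> b"
    using assms le_trans by (meson closed m_closed)
  then show ?thesis
    using c by (simp add: residuation)
qed

lemma mult_mono:
  assumes "a \<preceq> b" "c \<preceq> d"
    and "a \<in> carrier A" "b \<in> carrier A" "c \<in> carrier A" "d \<in> carrier A"
  shows "a \<otimes> c \<preceq> b \<otimes> d"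
  using assms mult_left_mono[of c d a] mult_left_mono[of a b d]
  by (metis le_trans m_closed m_comm)

lemma mult_le1: "\<lbrakk>x \<in> carrier A; y \<in> carrier A\<rbrakk> \<Longrightarrow> x \<otimes> y \<preceq> x"
  using mult_left_mono[of y \<one> x] one_greatest by simp

lemma mult_le2: "\<lbrakk>x \<in> carrier A; y \<in> carrier A\<rbrakk> \<Longrightarrow> x \<otimes> y \<preceq> y"
  by (metis mult_le1 m_comm)

lemma le_iff_imp: "\<lbrakk>x \<in> carrier A; y \<in> carrier A\<rbrakk> \<Longrightarrow> x \<preceq> y \<longleftrightarrow> x \<leadsto> y = \<one>"
  using residuation[of x y \<one>] by (simp add: one_le_iff)

lemma mult_imp_le: "\<lbrakk>x \<in> carrier A; y \<in> carrier A\<rbrakk> \<Longrightarrow> x \<otimes> (x \<leadsto> y) \<preceq> y"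
  by (metis divisibility meet_le2)

lemma le_imp: "\<lbrakk>x \<in> carrier A; y \<in> carrier A\<rbrakk> \<Longrightarrow> y \<preceq> x \<leadsto> y"
  by (simp add: residuation mult_le2)

lemma divisible: "\<lbrakk>x \<preceq> y; x \<in> carrier A; y \<in> carrier A\<rbrakk> \<Longrightarrow> y \<otimes> (y \<leadsto> x) = x"
  by (metis bl_le_def divisibility meet_comm)

text \<open>By residuation and associativity both sides have the same lower bounds, so each lies
  below the other.\<close>

lemma imp_curry:
  assumes "x \<in> carrier A" "y \<in> carrier A" "z \<in> carrier A"
  shows "x \<leadsto> (y \<leadsto> z) = (x \<otimes> y) \<leadsto> z"
proof -
  have eq: "w \<preceq> x \<leadsto> (y \<leadsto> z) \<longleftrightarrow> w \<preceq> (x \<otimes> y) \<leadsto> z" if "w \<in> carrier A" for w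
    using that assms by (simp add: residuation m_ac)
  show ?thesis
    using assms eq[of "x \<leadsto> (y \<leadsto> z)"] eq[of "(x \<otimes> y) \<leadsto> z"] by (intro le_antisym) auto
qed

text \<open>Multiplication by \<open>a\<close> has the right adjoint \<open>a \<leadsto> _\<close>,
  so it preserves joins.\<close>

lemma mult_join_distrib:
  assumes "a \<in> carrier A" "b \<in> carrier A" "c \<in> carrier A"
  shows "a \<otimes> (b \<curlyvee> c) = a \<otimes> b \<curlyvee> a \<otimes> c"
proof (rule le_antisym)
  have "b \<curlyvee> c \<preceq> a \<leadsto> (a \<otimes> b \<curlyvee> a \<otimes> c)"
    using assms by (intro join_leI) (auto simp: residuation)
  then show "a \<otimes> (b \<curlyvee> c) \<preceq> a \<otimes> b \<curlyvee> a \<otimes> c"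
    using assms by (simp add: residuation)
qed (use assms in \<open>auto intro!: join_leI mult_left_mono\<close>)

text \<open>Expresses the join by meet and residuum, so that closure of a subset under joins comes
  for free. For the harder inequality, the right-hand side times \<open>x \<leadsto> y\<close> is
  below \<open>y\<close> and times \<open>y \<leadsto> x\<close> is below \<open>x\<close>; by
  prelinearity these two factors join to \<open>\<one>\<close>.\<close>

lemma join_eq_imp:
  assumes c: "x \<in> carrier A" "y \<in> carrier A"
  shows "x \<curlyvee> y = ((x \<leadsto> y) \<leadsto> y) \<curlywedge> ((y \<leadsto> x) \<leadsto> x)" (is "_ = ?t")
proof (rule le_antisym)
  have le: "u \<preceq> (u \<leadsto> v) \<leadsto> v" if "u \<in> carrier A" "v \<in> carrier A" for u v
    using that mult_imp_le[of u v] by (simp add: residuation m_comm)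
  show "x \<curlyvee> y \<preceq> ?t"
    using c by (auto intro!: join_leI le_meetI le le_imp)
  have "?t \<otimes> (x \<leadsto> y) \<preceq> x \<curlyvee> y"
  proof (rule le_trans)
    show "?t \<otimes> (x \<leadsto> y) \<preceq> y"
      using c residuation[of "x \<leadsto> y" y ?t] by (simp add: m_comm)
  qed (use c in auto)
  moreover have "?t \<otimes> (y \<leadsto> x) \<preceq> x \<curlyvee> y"
  proof (rule le_trans)
    show "?t \<otimes> (y \<leadsto> x) \<preceq> x"
      using c residuation[of "y \<leadsto> x" x ?t] by (simp add: m_comm)
  qed (use c in auto)
  ultimately have "?t \<otimes> ((x \<leadsto> y) \<curlyvee> (y \<leadsto> x)) \<preceq> x \<curlyvee> y"
    using c by (simp add: mult_join_distrib join_leI)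
  then show "?t \<preceq> x \<curlyvee> y"
    using c by (simp add: prelinearity)
qed (use c in auto)

section \<open>Negation, nilpotent elements and prelinearity\<close>

lemma le_neg_iff: "\<lbrakk>x \<in> carrier A; y \<in> carrier A\<rbrakk> \<Longrightarrow> y \<preceq> neg x \<longleftrightarrow> x \<otimes> y = \<zero>"
  by (simp add: bl_neg_def residuation le_zero_iff)

lemma mult_neg: "x \<in> carrier A \<Longrightarrow> x \<otimes> neg x = \<zero>"
  using le_neg_iff[of x "neg x"] by simp

lemma le_neg_neg: "x \<in> carrier A \<Longrightarrow> x \<preceq> neg (neg x)"
  by (simp add: le_neg_iff mult_neg m_comm)

lemma neg_antimono: "\<lbrakk>x \<preceq> y; x \<in> carrier A; y \<in> carrier A\<rbrakk> \<Longrightarrow> neg y \<preceq> neg x"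
  by (metis le_neg_iff le_neg_neg le_trans m_comm neg_closed)

lemma neg_neg_neg: "x \<in> carrier A \<Longrightarrow> neg (neg (neg x)) = neg x"
  by (simp add: le_antisym le_neg_neg neg_antimono)

lemma imp_neg: "\<lbrakk>x \<in> carrier A; y \<in> carrier A\<rbrakk> \<Longrightarrow> x \<leadsto> neg y = neg (x \<otimes> y)"
  by (simp add: bl_neg_def imp_curry)

text \<open>Expanding \<open>(u [^] k \<curlyvee> v) \<otimes> (u \<curlyvee> v) = \<one>\<close>
  gives \<open>u [^] Suc k\<close> and terms with a factor \<open>v\<close>, which lie below
  \<open>v\<close>.\<close>

lemma join_pow_eq_one:
  assumes "u \<curlyvee> v = \<one>" and c: "u \<in> carrier A" "v \<in> carrier A"
  shows "u [^] (k::nat) \<curlyvee> v = \<one>"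
proof (induction k)
  case 0
  then show ?case
    using c by (simp add: le_antisym one_greatest)
next
  case (Suc k)
  have "\<one> = (u [^] k \<curlyvee> v) \<otimes> (u \<curlyvee> v)"
    using Suc assms by simp
  also have "\<dots> = (u [^] k \<otimes> u \<curlyvee> v \<otimes> u) \<curlyvee> (u [^] k \<curlyvee> v) \<otimes> v"
    using c by (simp add: mult_join_distrib m_comm[of "u [^] k \<curlyvee> v"] m_comm[of u])
  also have "\<dots> \<preceq> u [^] Suc k \<curlyvee> v"
  proof -
    have "w \<otimes> v \<preceq> u [^] Suc k \<curlyvee> v" if "w \<in> carrier A" for w
      using that c by (intro le_trans[OF mult_le2[of w v]]) auto
    moreover have "v \<otimes> u \<preceq> u [^] Suc k \<curlyvee> v"
      using c by (intro le_trans[OF mult_le1[of v u]]) auto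
    moreover have "u [^] k \<otimes> u \<preceq> u [^] Suc k \<curlyvee> v"
      using c le_join1[of "u [^] Suc k" v] by simp
    ultimately show ?thesis
      using c by (intro join_leI) auto
  qed
  finally show ?case
    using c one_le_iff by (simp del: nat_pow_Suc)
qed

definition nilpotent :: "'a \<Rightarrow> bool"
  where "nilpotent u \<longleftrightarrow> (\<exists>k::nat. u [^] k = \<zero>)"

lemma nilpotent_join_eq_one:
  assumes "nilpotent u" "u \<curlyvee> v = \<one>" "u \<in> carrier A" "v \<in> carrier A"
  shows "v = \<one>"
proof -
  obtain k :: nat where "u [^] k = \<zero>"
    using assms(1) by (auto simp: nilpotent_def)
  then have "\<zero> \<curlyvee> v = \<one>"
    using join_pow_eq_one assms by metis
  then show ?thesis
    using assms(4) le_iff_join zero_least zero_closed by auto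
qed

text \<open>Since \<open>z \<leadsto> neg z\<close> equals \<open>neg (z \<otimes> z)\<close>, it is
  nilpotent, so prelinearity for \<open>z\<close> and \<open>neg z\<close> leaves only
  \<open>neg z \<leadsto> z = \<one>\<close>.\<close>

lemma neg_le_self:
  assumes "nilpotent (neg (z \<otimes> z))" and z: "z \<in> carrier A"
  shows "neg z \<preceq> z"
proof -
  have "(z \<leadsto> neg z) \<curlyvee> (neg z \<leadsto> z) = \<one>"
    using z by (simp add: prelinearity)
  then have "neg z \<leadsto> z = \<one>"
    using assms nilpotent_join_eq_one[of "neg (z \<otimes> z)" "neg z \<leadsto> z"] by (simp add: imp_neg)
  then show ?thesis
    using z by (simp add: le_iff_imp)
qed

text \<open>
  With \<open>y = x\<^sup>-\<^sup>-\<close> and \<open>e = y \<rightarrow> x\<close>, so that \<open>x = y \<odot> e\<close>, one computes \<open>e \<rightarrow> x\<^sup>- = x\<^sup>-\<close>, hence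
  \<open>x\<^sup>- = e \<odot> x\<^sup>-\<close> and \<open>e \<rightarrow> y = y\<close>. Prelinearity for \<open>e\<close> and \<open>y\<close> then gives \<open>y \<le> e\<close>, and so
  \<open>y = e \<odot> (e \<rightarrow> y) = e \<odot> y = x\<close>.
\<close>
lemma neg_neg_eq:
  assumes "nilpotent (neg (neg x))" and x: "x \<in> carrier A"
  shows "neg (neg x) = x"
proof -
  define y where "y = neg (neg x)"
  define e where "e = y \<leadsto> x"
  have c [simp]: "y \<in> carrier A" "e \<in> carrier A" "neg x \<in> carrier A"
    using x by (simp_all add: y_def e_def)
  have "x \<preceq> y" and neg_y: "neg y = neg x"
    using x by (simp_all add: y_def le_neg_neg neg_neg_neg)
  then have x_eq: "x = y \<otimes> e"
    using x by (simp add: e_def divisible)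
  have imp_d: "e \<leadsto> neg x = neg x"
    using neg_y x_eq by (metis c(1,2) imp_neg m_comm)
  have "neg y \<preceq> e"
    using x by (simp add: e_def residuation mult_neg zero_least)
  then have "e \<otimes> neg x = neg x"
    using divisible[of "neg x" e] neg_y imp_d by simp
  then have imp_y: "e \<leadsto> y = y"
    using imp_neg[of e "neg x"] by (simp add: y_def[symmetric])
  then have "y \<curlyvee> (y \<leadsto> e) = \<one>"
    using prelinearity[of e y] by simp
  then have "y \<leadsto> e = \<one>"
    using nilpotent_join_eq_one[of y "y \<leadsto> e"] assms(1) by (simp add: y_def[symmetric])
  then have "y \<preceq> e"
    by (simp add: le_iff_imp)
  then have "y = e \<otimes> y"
    using divisible[of y e] imp_y by simp
  also have "\<dots> = x"
    using x_eq m_comm by simp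
  finally show ?thesis
    by (simp add: y_def)
qed

section \<open>Filters and the existence of maximal filters\<close>

lemma filterD:
  assumes "bl_filter A F"
  shows "F \<subseteq> carrier A" "F \<noteq> {}"
    and "\<lbrakk>x \<in> F; y \<in> F\<rbrakk> \<Longrightarrow> x \<otimes> y \<in> F"
    and "\<lbrakk>x \<in> F; x \<preceq> y; y \<in> carrier A\<rbrakk> \<Longrightarrow> y \<in> F"
  using assms by (auto simp: bl_filter_def)

lemma filter_one: "bl_filter A F \<Longrightarrow> \<one> \<in> F"
  unfolding bl_filter_def using one_greatest by blast

lemma filter_pow: "\<lbrakk>bl_filter A F; x \<in> F\<rbrakk> \<Longrightarrow> x [^] (k::nat) \<in> F"
  by (induction k) (simp_all add: filter_one filterD(3))

text \<open>Stated through \<open>\<zero>\<close>, properness visibly passes to unions of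
  chains.\<close>

lemma proper_filter_iff: "bl_proper_filter A F \<longleftrightarrow> bl_filter A F \<and> \<zero> \<notin> F"
proof -
  have "F = carrier A" if "bl_filter A F" "\<zero> \<in> F"
    using that filterD(1,4) zero_least by blast
  then show ?thesis
    by (auto simp: bl_proper_filter_def)
qed

text \<open>\<open>G\<close> is the filter generated by \<open>F\<close> and \<open>x\<close>:
  exponent 0 recovers \<open>F\<close>, while \<open>m = \<one>\<close> with exponent 1 gives
  \<open>x\<close>.\<close>

lemma filter_adjoin:
  assumes F: "bl_filter A F" and x: "x \<in> carrier A"
  defines "G \<equiv> {z \<in> carrier A. \<exists>m\<in>F. \<exists>n::nat. m \<otimes> x [^] n \<preceq> z}"
  shows "bl_filter A G" "F \<subseteq> G" "x \<in> G"
proof -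
  have FA: "m \<in> carrier A" if "m \<in> F" for m
    using that filterD(1)[OF F] by blast
  show sub: "F \<subseteq> G"
  proof
    fix m assume "m \<in> F"
    then have "m \<otimes> x [^] (0::nat) \<preceq> m"
      using FA by simp
    then show "m \<in> G"
      using \<open>m \<in> F\<close> FA unfolding G_def by blast
  qed
  have "\<one> \<otimes> x [^] (1::nat) \<preceq> x"
    using x by simp
  then show "x \<in> G"
    using x filter_one[OF F] unfolding G_def by blast
  have G_sub: "G \<subseteq> carrier A"
    by (auto simp: G_def)
  have "u \<otimes> v \<in> G" if uvG: "u \<in> G" "v \<in> G" for u v
  proof -
    obtain m n :: 'a and i j :: nat where
      mn: "m \<in> F" "n \<in> F" "m \<otimes> x [^] i \<preceq> u" "n \<otimes> x [^] j \<preceq> v"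
      and uv: "u \<in> carrier A" "v \<in> carrier A"
      using uvG unfolding G_def by blast
    have "(m \<otimes> x [^] i) \<otimes> (n \<otimes> x [^] j) \<preceq> u \<otimes> v"
      using mn uv x FA by (intro mult_mono) auto
    moreover have "(m \<otimes> x [^] i) \<otimes> (n \<otimes> x [^] j) = (m \<otimes> n) \<otimes> x [^] (i + j)"
      using mn x FA by (simp add: nat_pow_mult[symmetric] m_ac)
    ultimately have "(m \<otimes> n) \<otimes> x [^] (i + j) \<preceq> u \<otimes> v"
      by simp
    moreover have "m \<otimes> n \<in> F"
      using mn filterD(3)[OF F] by blast
    ultimately show ?thesis
      using uv unfolding G_def by blast
  qed
  moreover have "v \<in> G" if uG: "u \<in> G" and uv: "u \<preceq> v" "v \<in> carrier A" for u v
  proof -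
    obtain m and i :: nat where m: "m \<in> F" "m \<otimes> x [^] i \<preceq> u" "u \<in> carrier A"
      using uG unfolding G_def by blast
    then have "m \<otimes> x [^] i \<preceq> v"
      using uv x FA by (intro le_trans[OF m(2)]) auto
    then show ?thesis
      using m uv unfolding G_def by blast
  qed
  ultimately show "bl_filter A G"
    unfolding bl_filter_def using sub filterD(2)[OF F] G_sub by blast
qed

lemma proper_filter_Union:
  assumes "subset.chain {F. bl_proper_filter A F} C" and "C \<noteq> {}"
  shows "bl_proper_filter A (\<Union>C)"
proof -
  have C: "bl_filter A F" "\<zero> \<notin> F" if "F \<in> C" for F
    using that assms(1) unfolding subset.chain_def proper_filter_iff by blast+
  have "x \<otimes> y \<in> \<Union>C" if "x \<in> F" "y \<in> G" "F \<in> C" "G \<in> C" for x y F G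
  proof -
    \<comment> \<open>Comparability puts both factors into the larger of the two filters, which
      contains their product.\<close>
    have "F \<subseteq> G \<or> G \<subseteq> F"
      using that(3,4) assms(1) unfolding subset.chain_def by blast
    then have "x \<otimes> y \<in> F \<or> x \<otimes> y \<in> G"
    proof
      assume "F \<subseteq> G"
      then have "x \<in> G"
        using that(1) by (rule subsetD)
      then show ?thesis
        using filterD(3)[OF C(1)[OF that(4)]] that(2) by blast
    next
      assume "G \<subseteq> F"
      then have "y \<in> F"
        using that(2) by (rule subsetD)
      then show ?thesis
        using filterD(3)[OF C(1)[OF that(3)]] that(1) by blast
    qed
    then show ?thesis
      using that(3,4) by blast
  qed
  moreover have "y \<in> \<Union>C" if "x \<in> F" "F \<in> C" "x \<preceq> y" "y \<in> carrier A" for x y F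
    using filterD(4)[OF C(1)[OF that(2)]] that by blast
  moreover have "\<Union>C \<subseteq> carrier A"
    using C(1) filterD(1) by blast
  moreover have "\<Union>C \<noteq> {}"
    using C(1) filterD(2) assms(2) by blast
  ultimately have "bl_filter A (\<Union>C)"
    unfolding bl_filter_def by blast
  then show ?thesis
    using C(2) proper_filter_iff by blast
qed

lemma ex_maximal_filter:
  assumes "bl_proper_filter A F"
  obtains M where "bl_maximal_filter A M" "F \<subseteq> M"
proof -
  let ?P = "{G. bl_proper_filter A G \<and> F \<subseteq> G}"
  have "\<exists>M\<in>?P. \<forall>X\<in>?P. M \<subseteq> X \<longrightarrow> X = M"
  proof (rule subset_Zorn_nonempty)
    show "?P \<noteq> {}"
      using assms by blast
  next
    fix C assume C: "C \<noteq> {}" "subset.chain ?P C"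
    have "subset.chain {G. bl_proper_filter A G} C"
      using C(2) unfolding subset.chain_def by blast
    then have "bl_proper_filter A (\<Union>C)"
      using C(1) by (rule proper_filter_Union)
    moreover have "F \<subseteq> \<Union>C"
      using C unfolding subset.chain_def by blast
    ultimately show "\<Union>C \<in> ?P"
      by simp
  qed
  then obtain M where M: "M \<in> ?P" and max: "\<forall>X\<in>?P. M \<subseteq> X \<longrightarrow> X = M"
    by (rule bexE)
  have "bl_maximal_filter A M"
    unfolding bl_maximal_filter_def
  proof (intro conjI notI)
    show "bl_proper_filter A M"
      using M by simp
  next
    assume "\<exists>G. bl_proper_filter A G \<and> M \<subset> G"
    then obtain G where G: "bl_proper_filter A G" "M \<subset> G"
      by (elim exE conjE)
    then have "G \<in> ?P"
      using M by auto
    then show False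
      using max G(2) by auto
  qed
  moreover have "F \<subseteq> M"
    using M by simp
  ultimately show thesis
    by (rule that)
qed

section \<open>The radical and its elementwise description\<close>

lemma filter_singleton_one: "bl_filter A {\<one>}"
  by (auto simp: bl_filter_def one_le_iff)

lemma maximal_filterD: "bl_maximal_filter A M \<Longrightarrow> bl_filter A M \<and> \<zero> \<notin> M"
  by (simp add: bl_maximal_filter_def proper_filter_iff)

lemma filter_Rad: "bl_filter A (bl_Rad A)"
proof -
  have F: "bl_filter A M" if "bl_maximal_filter A M" for M
    using maximal_filterD[OF that] by blast
  have Rad: "x \<in> bl_Rad A \<longleftrightarrow> x \<in> carrier A \<and> (\<forall>M. bl_maximal_filter A M \<longrightarrow> x \<in> M)" for x
    by (simp add: bl_Rad_def)
  have "\<one> \<in> bl_Rad A"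
    by (simp add: Rad F filter_one)
  moreover have "x \<otimes> y \<in> bl_Rad A" if "x \<in> bl_Rad A" "y \<in> bl_Rad A" for x y
    using that by (simp add: Rad F filterD(3))
  moreover have "y \<in> bl_Rad A" if x: "x \<in> bl_Rad A" and y: "x \<preceq> y" "y \<in> carrier A" for x y
  proof -
    have "y \<in> M" if "bl_maximal_filter A M" for M
      using filterD(4)[OF F[OF that] _ y] x that Rad by blast
    then show ?thesis
      using y(2) Rad by blast
  qed
  moreover have "bl_Rad A \<subseteq> carrier A"
    by (simp add: bl_Rad_def)
  ultimately show ?thesis
    unfolding bl_filter_def by blast
qed

lemma Rad_subset: "x \<in> bl_Rad A \<Longrightarrow> x \<in> carrier A"
  by (simp add: bl_Rad_def)

text \<open>Removes maximal filters from the description of the radical. If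
  \<open>neg (x [^] n)\<close> is not nilpotent, some maximal filter contains it and so cannot
  contain \<open>x\<close>. If a maximal \<open>M\<close> omits \<open>x\<close>, then adjoining
  \<open>x\<close> yields \<open>\<zero>\<close>, which forces some \<open>neg (x [^] n)\<close> and
  all its powers into \<open>M\<close>.\<close>

lemma Rad_iff:
  assumes x: "x \<in> carrier A"
  shows "x \<in> bl_Rad A \<longleftrightarrow> (\<forall>n::nat. nilpotent (neg (x [^] n)))"
proof (intro iffI allI)
  fix n :: nat
  assume Rad: "x \<in> bl_Rad A"
  let ?u = "neg (x [^] n)"
  have u: "?u \<in> carrier A"
    using x by simp
  \<comment> \<open>The filter generated by \<open>?u\<close>, written as an adjunction to the least
    filter \<open>{\<one>}\<close> so that \<open>filter_adjoin\<close> applies.\<close>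
  let ?F = "{z \<in> carrier A. \<exists>m\<in>{\<one>}. \<exists>k::nat. m \<otimes> ?u [^] k \<preceq> z}"
  note F = filter_adjoin[OF filter_singleton_one u]
  show "nilpotent ?u"
  proof (rule ccontr)
    assume "\<not> nilpotent ?u"
    then have "\<zero> \<notin> ?F"
      using u by (auto simp: nilpotent_def le_zero_iff)
    then have "bl_proper_filter A ?F"
      using F(1) proper_filter_iff by blast
    then obtain M where M: "bl_maximal_filter A M" "?F \<subseteq> M"
      by (rule ex_maximal_filter)
    then have fM: "bl_filter A M" "\<zero> \<notin> M"
      using maximal_filterD by auto
    have "x [^] n \<in> M"
      using Rad M(1) fM(1) by (auto simp: bl_Rad_def intro: filter_pow)
    moreover have "?u \<in> M"
      using M(2) F(3) by (rule subsetD)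
    ultimately have "x [^] n \<otimes> ?u \<in> M"
      by (rule filterD(3)[OF fM(1)])
    then show False
      using fM(2) x by (simp add: mult_neg)
  qed
next
  assume nil: "\<forall>n::nat. nilpotent (neg (x [^] n))"
  have "x \<in> M" if M: "bl_maximal_filter A M" for M
  proof (rule ccontr)
    assume "x \<notin> M"
    have fM: "bl_filter A M" "\<zero> \<notin> M"
      using maximal_filterD[OF M] by auto
    let ?G = "{z \<in> carrier A. \<exists>m\<in>M. \<exists>n::nat. m \<otimes> x [^] n \<preceq> z}"
    note G = filter_adjoin[OF fM(1) x]
    have "M \<subset> ?G"
      using G(2,3) \<open>x \<notin> M\<close> by blast
    then have "\<not> bl_proper_filter A ?G"
      using M unfolding bl_maximal_filter_def by blast
    then have "\<zero> \<in> ?G"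
      using G(1) proper_filter_iff by blast
    then obtain m and n :: nat where m: "m \<in> M" "m \<otimes> x [^] n \<preceq> \<zero>"
      by blast
    have mc: "m \<in> carrier A"
      using m filterD(1)[OF fM(1)] by blast
    then have "m \<preceq> neg (x [^] n)"
      using m(2) x by (simp add: le_neg_iff le_zero_iff m_comm)
    then have "neg (x [^] n) \<in> M"
      using filterD(4)[OF fM(1) m(1)] x by simp
    moreover obtain k :: nat where "neg (x [^] n) [^] k = \<zero>"
      using nil by (auto simp: nilpotent_def)
    ultimately show False
      using filter_pow[OF fM(1)] fM(2) by metis
  qed
  then show "x \<in> bl_Rad A"
    using x by (simp add: bl_Rad_def)
qed

lemma Rad_nilpotent_neg:
  assumes "x \<in> bl_Rad A"
  shows "nilpotent (neg x)"
proof -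
  have "nilpotent (neg (x [^] (1::nat)))"
    using assms Rad_iff Rad_subset by blast
  then show ?thesis
    using assms Rad_subset by simp
qed

text \<open>The radical is closed under products, so \<open>x \<otimes> x\<close> lies in it and has
  a nilpotent negation, as \<open>neg_le_self\<close> demands.\<close>

lemma Rad_neg_le:
  assumes "x \<in> bl_Rad A"
  shows "neg x \<preceq> x"
  using assms filterD(3)[OF filter_Rad] Rad_subset Rad_nilpotent_neg neg_le_self by blast

lemma Rad_neg_neg: "x \<in> bl_Rad A \<Longrightarrow> neg (neg x) \<in> bl_Rad A"
  using filterD(4)[OF filter_Rad] Rad_subset le_neg_neg neg_closed by metis

section \<open>Subalgebras and their radicals\<close>

lemma subalgebra:
  assumes sub: "S \<subseteq> carrier A" and z: "\<zero> \<in> S"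
    and mult: "\<And>x y. \<lbrakk>x \<in> S; y \<in> S\<rbrakk> \<Longrightarrow> x \<otimes> y \<in> S"
    and imp: "\<And>x y. \<lbrakk>x \<in> S; y \<in> S\<rbrakk> \<Longrightarrow> x \<leadsto> y \<in> S"
  shows "bl_algebra (A\<lparr>carrier := S\<rparr>)"
proof -
  have S [simp]: "x \<in> carrier A" if "x \<in> S" for x
    using that sub by blast
  \<comment> \<open>The remaining operations are terms in \<open>\<zero>\<close>, product and
    residuum: \<open>\<one>\<close> is \<open>\<zero> \<leadsto> \<zero>\<close>, meets come from
    divisibility and joins from \<open>join_eq_imp\<close>.\<close>
  have one: "\<one> \<in> S"
    using imp[OF z z] le_iff_imp[of \<zero> \<zero>] by simp
  have meet: "x \<curlywedge> y \<in> S" if "x \<in> S" "y \<in> S" for x y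
    using that mult imp by (simp add: divisibility)
  have join: "x \<curlyvee> y \<in> S" if "x \<in> S" "y \<in> S" for x y
    using that meet imp by (simp add: join_eq_imp)
  show ?thesis
    by unfold_locales
      (simp_all add: mult imp meet join one z m_assoc bl_le_def
        meet_assoc join_assoc meet_join_absorb join_meet_absorb zero_least[unfolded bl_le_def]
        one_greatest[unfolded bl_le_def] residuation[unfolded bl_le_def] divisibility[symmetric]
        prelinearity, simp_all add: m_comm meet_comm join_comm)
qed

text \<open>The criterion \<open>Rad_iff\<close> for \<open>x\<close> mentions only powers, negation
  and \<open>\<zero>\<close>, which are computed alike in \<open>S\<close> and in
  \<open>A\<close>.\<close>

lemma Rad_subalgebra:
  assumes "bl_algebra (A\<lparr>carrier := S\<rparr>)" and "S \<subseteq> carrier A"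
  shows "bl_Rad (A\<lparr>carrier := S\<rparr>) = bl_Rad A \<inter> S"
proof -
  interpret S: bl_algebra "A\<lparr>carrier := S\<rparr>"
    by fact
  have nil: "S.nilpotent u \<longleftrightarrow> nilpotent u" for u
    by (simp add: S.nilpotent_def nilpotent_def nat_pow_consistent[symmetric])
  have neg: "S.neg u = neg u" for u
    by (simp add: bl_neg_def)
  have "x \<in> bl_Rad (A\<lparr>carrier := S\<rparr>) \<longleftrightarrow> x \<in> bl_Rad A" if "x \<in> S" for x
    using that assms(2) Rad_iff[of x] S.Rad_iff[of x]
    by (auto simp: nil neg nat_pow_consistent[symmetric])
  then show ?thesis
    using S.Rad_subset by auto
qed

end

section \<open>State-operators, their image and perfection\<close>

context state_bl_algebra
begin

lemma state_neg: "x \<in> carrier A \<Longrightarrow> \<sigma> (neg x) = neg (\<sigma> x)"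
  using state_imp[of x \<zero>] zero_least[of x]
  by (simp add: bl_neg_def state_zero bl_le_def meet_comm)

text \<open>By divisibility \<open>x\<close> is the multiple
  \<open>y \<otimes> (y \<leadsto> x)\<close> of \<open>y\<close>, and \<open>state_mult\<close>
  turns this into a multiple of \<open>\<sigma> y\<close>.\<close>

lemma state_mono:
  assumes "x \<preceq> y" and c: "x \<in> carrier A" "y \<in> carrier A"
  shows "\<sigma> x \<preceq> \<sigma> y"
proof -
  have "\<sigma> x = \<sigma> y \<otimes> \<sigma> (y \<leadsto> x)"
    using state_mult[of y "y \<leadsto> x"] divisible[OF assms] c by simp
  then show ?thesis
    using c by (simp add: mult_le1 state_closed)
qed

lemma image_subset: "\<sigma> ` carrier A \<subseteq> carrier A"
  by (auto intro: state_closed)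

lemma bl_algebra_image: "bl_algebra (bl_image A \<sigma>)"
  unfolding bl_image_def
proof (rule subalgebra[OF image_subset])
  show "\<zero> \<in> \<sigma> ` carrier A"
    by (metis imageI state_zero zero_closed)
  show "u \<otimes> v \<in> \<sigma> ` carrier A" if uv: "u \<in> \<sigma> ` carrier A" "v \<in> \<sigma> ` carrier A" for u v
  proof -
    obtain x y where xy: "x \<in> carrier A" "y \<in> carrier A" "u = \<sigma> x" "v = \<sigma> y"
      using uv by blast
    \<comment> \<open>A product of images is fixed by \<open>\<sigma>\<close>, hence is itself an
      image; the same holds below for the residuum.\<close>
    then have "\<sigma> (u \<otimes> v) = u \<otimes> v"
      by (simp add: state_mult_image)
    moreover have "u \<otimes> v \<in> carrier A"
      using xy by (simp add: state_closed)
    ultimately show ?thesis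
      by (metis imageI)
  qed
  show "u \<leadsto> v \<in> \<sigma> ` carrier A" if uv: "u \<in> \<sigma> ` carrier A" "v \<in> \<sigma> ` carrier A" for u v
  proof -
    obtain x y where xy: "x \<in> carrier A" "y \<in> carrier A" "u = \<sigma> x" "v = \<sigma> y"
      using uv by blast
    then have "\<sigma> (u \<leadsto> v) = u \<leadsto> v"
      by (simp add: state_imp_image)
    moreover have "u \<leadsto> v \<in> carrier A"
      using xy by (simp add: state_closed)
    ultimately show ?thesis
      by (metis imageI)
  qed
qed

lemma Rad_image: "bl_Rad (bl_image A \<sigma>) = bl_Rad A \<inter> \<sigma> ` carrier A"
  unfolding bl_image_def
  by (rule Rad_subalgebra[OF bl_algebra_image[unfolded bl_image_def] image_subset])

text \<open>Otherwise \<open>neg x\<close> is in the radical, so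
  \<open>neg (neg x) \<preceq> neg x\<close>. Applying \<open>\<sigma>\<close> carries this
  inequality to \<open>\<sigma> x\<close>, which puts both \<open>\<sigma> x\<close> and its
  negation into the radical.\<close>

lemma perfect_state_Rad:
  assumes perfect: "bl_perfect A" and x: "x \<in> carrier A" and Rad: "\<sigma> x \<in> bl_Rad A"
  shows "x \<in> bl_Rad A"
proof (rule ccontr)
  assume "x \<notin> bl_Rad A"
  then obtain y where y: "y \<in> bl_Rad A" "x = neg y"
    using perfect x by (auto simp: bl_perfect_def)
  then have "neg x \<in> bl_Rad A"
    using Rad_neg_neg by simp
  then have "neg (neg x) \<preceq> neg x"
    by (rule Rad_neg_le)
  then have "neg (neg (\<sigma> x)) \<preceq> neg (\<sigma> x)"
    using x state_mono[of "neg (neg x)" "neg x"] by (simp add: state_neg)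
  then have "neg (\<sigma> x) \<in> bl_Rad A"
    using filterD(4)[OF filter_Rad Rad_neg_neg[OF Rad]] x by (simp add: state_closed)
  \<comment> \<open>This alone is not absurd, as the radical of the one-element algebra is
    everything; the contradiction is with \<open>x \<notin> bl_Rad A\<close>.\<close>
  then have "\<zero> \<in> bl_Rad A"
    using filterD(3)[OF filter_Rad Rad] x by (metis mult_neg state_closed)
  then have "x \<in> bl_Rad A"
    using filterD(4)[OF filter_Rad] x zero_least by blast
  then show False
    using \<open>x \<notin> bl_Rad A\<close> by blast
qed

lemma perfect_image:
  assumes "bl_perfect A"
  shows "bl_perfect (bl_image A \<sigma>)"
proof -
  have "a \<in> neg ` (bl_Rad A \<inter> \<sigma> ` carrier A)"
    if a: "a \<in> \<sigma> ` carrier A" "a \<notin> bl_Rad A" for a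
  proof -
    obtain y where y: "y \<in> bl_Rad A" "a = neg y"
      using assms a image_subset by (auto simp: bl_perfect_def)
    \<comment> \<open>The witness \<open>y\<close> may lie outside the image; \<open>neg a\<close>,
      which is \<open>neg (neg y)\<close>, replaces it and is an image because
      \<open>\<sigma>\<close> commutes with negation.\<close>
    have "neg a \<in> bl_Rad A" "neg (neg a) = a"
      using y by (auto simp: Rad_neg_neg neg_neg_neg Rad_subset)
    moreover have "neg a \<in> \<sigma> ` carrier A"
      using a(1) by (auto simp flip: state_neg)
    ultimately show ?thesis
      by (metis IntI imageI)
  qed
  then show ?thesis
    unfolding bl_perfect_def Rad_image by (auto simp: bl_image_def bl_neg_def)
qed

lemma perfect_if_image_perfect:
  assumes refl: "\<And>x. \<lbrakk>x \<in> carrier A; \<sigma> x \<in> bl_Rad A\<rbrakk> \<Longrightarrow> x \<in> bl_Rad A"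
    and perfect: "bl_perfect (bl_image A \<sigma>)"
  shows "bl_perfect A"
  unfolding bl_perfect_def
proof
  fix x assume x: "x \<in> carrier A"
  then have "\<sigma> x \<in> bl_Rad A \<or> \<sigma> x \<in> neg ` bl_Rad A"
    using perfect unfolding bl_perfect_def Rad_image by (auto simp: bl_image_def bl_neg_def)
  then show "x \<in> bl_Rad A \<or> x \<in> neg ` bl_Rad A"
  proof
    assume "\<sigma> x \<in> neg ` bl_Rad A"
    \<comment> \<open>If \<open>\<sigma> x = neg y\<close> with \<open>y\<close> in the radical,
      then \<open>\<sigma> (neg x) = neg (neg y)\<close> lies above \<open>y\<close>.\<close>
    then have "\<sigma> (neg x) \<in> bl_Rad A"
      using x by (auto simp: state_neg Rad_neg_neg)
    then have Rad: "neg x \<in> bl_Rad A"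
      using refl x by simp
    \<comment> \<open>This makes \<open>neg x\<close> the radical element whose negation is
      \<open>x\<close>.\<close>
    then have "neg (neg x) = x"
      using x by (simp add: neg_neg_eq Rad_nilpotent_neg)
    then show ?thesis
      using Rad by (metis imageI)
  qed (use refl x in blast)
qed

end

theorem theorem7p6:
  fixes A :: "('a, 'm) bl_scheme" and \<sigma> :: "'a \<Rightarrow> 'a"
  assumes "state_bl_algebra A \<sigma>"
  shows "bl_perfect A \<longleftrightarrow>
    (\<forall>x\<in>carrier A. \<sigma> x \<in> bl_Rad A \<longrightarrow> x \<in> bl_Rad A) \<and> bl_perfect (bl_image A \<sigma>)"
proof -
  interpret state_bl_algebra A \<sigma>
    by fact
  show ?thesis
    using perfect_state_Rad perfect_image perfect_if_image_perfect by blast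
qed

end
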